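(* Let $\Gamma$ be any countable algebraically closed graph that is not isomorphic to the countable universal graph $R$. Then there exists a non-regular injective endomorphism $f$ of $R$ such that the subgraph of $R$ induced by the images of the vertices under $f$ is isomorphic to $\Gamma$ and such that the $\mathscr{D}$-class of $f$ in $\operatorname{End} R$ contains $2^{\aleph_0}$ many $\mathscr{R}$-classes and $2^{\aleph_0}$ many $\mathscr{L}$-classes.
   Context: A graph is a pair $(V,E)$ with $E$ an irreflexive symmetric binary relation on $V$. A graph is algebraically closed if for every finite set $A$ of vertices there is a vertex adjacent to every vertex of $A$. The countable universal graph $R$ is the Fraïssé limit of the finite graphs. The subgraph induced by a vertex set $U$ has vertex set $U$ and all edges of $R$ between vertices of $U$. Green's relations on the monoid $M=\operatorname{End} R$: $f\,\mathscr{L}\,g$ iff $Mf=Mg$; $f\,\mathscr{R}\,g$ iff $fM=gM$; $\mathscr{D}=\mathscr{L}\circ\mathscr{R}$. An element $f$ is regular if $fgf=f$ for some $g\in M$. *)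

theory Defs
  imports "HOL-Algebra.Coset" "HOL-Library.Countable_Set" "HOL-Library.Equipollence"
begin

type_synonym 'a graph = "'a set \<times> 'a rel"

abbreviation verts :: "'a graph \<Rightarrow> 'a set" where
  "verts \<equiv> fst"

abbreviation edges :: "'a graph \<Rightarrow> 'a rel" where
  "edges \<equiv> snd"

definition graph :: "'a graph \<Rightarrow> bool" where
  "graph G \<longleftrightarrow> edges G \<subseteq> verts G \<times> verts G \<and> irrefl (edges G) \<and> sym (edges G)"

definition algebraically_closed :: "'a graph \<Rightarrow> bool" where
  "algebraically_closed G \<longleftrightarrow>
     (\<forall>A. finite A \<and> A \<subseteq> verts G \<longrightarrow> (\<exists>v\<in>verts G. \<forall>a\<in>A. (v, a) \<in> edges G))"

definition induced :: "'a graph \<Rightarrow> 'a set \<Rightarrow> 'a graph" where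
  "induced G U = (U, edges G \<inter> U \<times> U)"

definition graph_hom :: "'a graph \<Rightarrow> 'b graph \<Rightarrow> ('a \<Rightarrow> 'b) \<Rightarrow> bool" where
  "graph_hom G H f \<longleftrightarrow>
     f \<in> verts G \<rightarrow> verts H \<and> (\<forall>x y. (x, y) \<in> edges G \<longrightarrow> (f x, f y) \<in> edges H)"

definition graph_embedding :: "'a graph \<Rightarrow> 'b graph \<Rightarrow> ('a \<Rightarrow> 'b) \<Rightarrow> bool" where
  "graph_embedding G H f \<longleftrightarrow>
     f \<in> verts G \<rightarrow> verts H \<and> inj_on f (verts G) \<and>
     (\<forall>x\<in>verts G. \<forall>y\<in>verts G. (x, y) \<in> edges G \<longleftrightarrow> (f x, f y) \<in> edges H)"

definition graph_iso :: "'a graph \<Rightarrow> 'b graph \<Rightarrow> ('a \<Rightarrow> 'b) \<Rightarrow> bool" where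
  "graph_iso G H f \<longleftrightarrow>
     bij_betw f (verts G) (verts H) \<and>
     (\<forall>x\<in>verts G. \<forall>y\<in>verts G. (x, y) \<in> edges G \<longleftrightarrow> (f x, f y) \<in> edges H)"

definition isomorphic :: "'a graph \<Rightarrow> 'b graph \<Rightarrow> bool" where
  "isomorphic G H \<longleftrightarrow> (\<exists>f. graph_iso G H f)"

text \<open>Every finite graph is isomorphic to one whose vertices are natural numbers, so classes of
  finite graphs closed under isomorphism are represented by sets of graphs on natural numbers.\<close>

definition finite_graphs :: "nat graph set" where
  "finite_graphs = {H. graph H \<and> finite (verts H)}"

definition age :: "'a graph \<Rightarrow> nat graph set" where
  "age G = {H \<in> finite_graphs. \<exists>f. graph_embedding H G f}"

definition homogeneous :: "'a graph \<Rightarrow> bool" where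
  "homogeneous G \<longleftrightarrow>
     (\<forall>A B h. finite A \<and> A \<subseteq> verts G \<and> B \<subseteq> verts G \<and> graph_iso (induced G A) (induced G B) h
        \<longrightarrow> (\<exists>g. graph_iso G G g \<and> (\<forall>x\<in>A. g x = h x)))"

definition fraisse_limit :: "nat graph set \<Rightarrow> 'a graph \<Rightarrow> bool" where
  "fraisse_limit K G \<longleftrightarrow> graph G \<and> countable (verts G) \<and> homogeneous G \<and> age G = K"

text \<open>Endomorphisms are taken to be undefined outside the vertex set, so that equality in the
  monoid is equality of maps on the vertices.\<close>

definition End :: "'a graph \<Rightarrow> ('a \<Rightarrow> 'a) monoid" where
  "End G = \<lparr>carrier = {f \<in> extensional (verts G). graph_hom G G f},
            mult = compose (verts G),
            one = (\<lambda>x\<in>verts G. x)\<rparr>"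

lemma monoid_End:
  assumes "graph G"
  shows "monoid (End G)"
proof -
  have *: "x \<in> verts G" "y \<in> verts G" if "(x, y) \<in> edges G" for x y
    using assms that by (auto simp: graph_def)
  show ?thesis
  proof (rule monoidI)
    fix f g assume "f \<in> carrier (End G)" "g \<in> carrier (End G)"
    then show "f \<otimes>\<^bsub>End G\<^esub> g \<in> carrier (End G)"
      by (auto simp: End_def graph_hom_def compose_eq * Pi_iff)
  next
    show "\<one>\<^bsub>End G\<^esub> \<in> carrier (End G)"
      by (auto simp: End_def graph_hom_def *)
  next
    fix f g h assume "f \<in> carrier (End G)" "g \<in> carrier (End G)" "h \<in> carrier (End G)"
    then show "f \<otimes>\<^bsub>End G\<^esub> g \<otimes>\<^bsub>End G\<^esub> h = f \<otimes>\<^bsub>End G\<^esub> (g \<otimes>\<^bsub>End G\<^esub> h)"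
      by (auto simp: End_def graph_hom_def compose_def Pi_iff fun_eq_iff)
  next
    fix f assume "f \<in> carrier (End G)"
    then show "\<one>\<^bsub>End G\<^esub> \<otimes>\<^bsub>End G\<^esub> f = f" "f \<otimes>\<^bsub>End G\<^esub> \<one>\<^bsub>End G\<^esub> = f"
      by (auto simp: End_def graph_hom_def compose_def extensional_def Pi_iff fun_eq_iff)
  qed
qed

text \<open>In a monoid \<open>M\<close>, \<open>carrier M #>\<^bsub>M\<^esub> f\<close> is the principal left ideal \<open>Mf\<close> and
  \<open>f <#\<^bsub>M\<^esub> carrier M\<close> is the principal right ideal \<open>fM\<close>.\<close>

definition green_L :: "('a, 'b) monoid_scheme \<Rightarrow> 'a rel" where
  "green_L M = {(f, g). f \<in> carrier M \<and> g \<in> carrier M \<and>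
                        carrier M #>\<^bsub>M\<^esub> f = carrier M #>\<^bsub>M\<^esub> g}"

definition green_R :: "('a, 'b) monoid_scheme \<Rightarrow> 'a rel" where
  "green_R M = {(f, g). f \<in> carrier M \<and> g \<in> carrier M \<and>
                        f <#\<^bsub>M\<^esub> carrier M = g <#\<^bsub>M\<^esub> carrier M}"

definition green_D :: "('a, 'b) monoid_scheme \<Rightarrow> 'a rel" where
  "green_D M = green_L M O green_R M"

definition regular_elem :: "('a, 'b) monoid_scheme \<Rightarrow> 'a \<Rightarrow> bool" where
  "regular_elem M f \<longleftrightarrow> (\<exists>g\<in>carrier M. f \<otimes>\<^bsub>M\<^esub> g \<otimes>\<^bsub>M\<^esub> f = f)"

end

theory Submission
  imports Defs "HOL-Library.Nat_Bijection"
begin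

text \<open>A bijective homomorphism \<open>R \<rightarrow> \<Gamma>\<close> followed by an embedding \<open>\<Gamma> \<rightarrow> R\<close> is an injective endomorphism
  \<open>f\<close>; if it were regular it would be left invertible, hence reflect edges, and \<open>\<Gamma>\<close> would be
  isomorphic to \<open>R\<close>. Every countable graph embeds into \<open>R\<close> in such a way that all homomorphisms from
  it to \<open>R\<close> extend to endomorphisms of \<open>R\<close>. Applied to \<open>\<Gamma>\<close> with all vertices doubled, this gives
  continuum many copies of \<open>\<Gamma>\<close> in \<open>R\<close> and \<open>\<L>\<close>-related endomorphisms onto them; they lie in different
  \<open>\<R>\<close>-classes because \<open>\<R>\<close>-related maps have equal images. Applied to \<open>R\<close> with isolated vertices added,
  it gives continuum many right invertible \<open>h\<close> with different kernels; the products \<open>fh\<close> are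
  \<open>\<R>\<close>-related to \<open>f\<close> and lie in different \<open>\<L>\<close>-classes because \<open>\<L>\<close>-related maps have equal kernels.\<close>

section \<open>The extension property\<close>

text \<open>\<open>F\<close> splits into prescribed neighbours \<open>F \<inter> N\<close> and
  prescribed non-neighbours \<open>F - N\<close>, the usual condition with two disjoint finite sets.
  That \<open>v\<close> avoids \<open>F\<close> has to be stated: irreflexivity separates
  \<open>v\<close> only from the prescribed neighbours.\<close>

definition extension_property :: "'a graph \<Rightarrow> bool" where
  "extension_property G \<longleftrightarrow>
     (\<forall>F N. finite F \<and> F \<subseteq> verts G \<longrightarrow>
        (\<exists>v\<in>verts G - F. \<forall>a\<in>F. (v, a) \<in> edges G \<longleftrightarrow> a \<in> N))"

lemma extension_propertyE:
  assumes "extension_property G" "finite F" "F \<subseteq> verts G"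
  obtains v where "v \<in> verts G" "v \<notin> F" "\<And>a. a \<in> F \<Longrightarrow> (v, a) \<in> edges G \<longleftrightarrow> a \<in> N"
  using assms unfolding extension_property_def by (metis DiffD1 DiffD2)

lemma graph_edges:
  assumes "graph G"
  shows graph_edge_verts: "(x, y) \<in> edges G \<Longrightarrow> x \<in> verts G \<and> y \<in> verts G"
    and graph_edge_irrefl: "(x, x) \<notin> edges G"
    and graph_edge_commute: "(x, y) \<in> edges G \<longleftrightarrow> (y, x) \<in> edges G"
  using assms by (auto simp: graph_def irrefl_def sym_def)

lemma graphI:
  assumes "\<And>x y. (x, y) \<in> edges G \<Longrightarrow> x \<in> verts G \<and> y \<in> verts G"
    and "\<And>x. (x, x) \<notin> edges G" and "\<And>x y. (x, y) \<in> edges G \<Longrightarrow> (y, x) \<in> edges G"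
  shows "graph G"
  using assms unfolding graph_def irrefl_def sym_def by auto

lemma graph_iso_the_inv_into:
  assumes "graph_iso G H f"
  shows "graph_iso H G (the_inv_into (verts G) f)"
  unfolding graph_iso_def
proof (intro conjI ballI)
  have f: "bij_betw f (verts G) (verts H)" using assms by (simp add: graph_iso_def)
  then show "bij_betw (the_inv_into (verts G) f) (verts H) (verts G)"
    by (rule bij_betw_the_inv_into)
  fix x y assume "x \<in> verts H" "y \<in> verts H"
  then obtain x' y' where "x' \<in> verts G" "x = f x'" "y' \<in> verts G" "y = f y'"
    using bij_betw_imp_surj_on[OF f] by blast
  then show "(x, y) \<in> edges H \<longleftrightarrow>
      (the_inv_into (verts G) f x, the_inv_into (verts G) f y) \<in> edges G"
    using assms f by (simp add: graph_iso_def the_inv_into_f_f bij_betw_imp_inj_on)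
qed

text \<open>The graph induced on \<open>F\<close>, enlarged by one vertex with the wanted
  neighbours, is finite and hence embeds into \<open>R\<close>. By homogeneity an automorphism moves
  the embedded copy of \<open>F\<close> back onto \<open>F\<close>; it moves the extra vertex to the
  vertex sought.\<close>

lemma fraisse_limit_extension_property:
  assumes "fraisse_limit finite_graphs R"
  shows "extension_property R"
  unfolding extension_property_def
proof (intro allI impI, elim conjE)
  fix F N assume F: "finite F" "F \<subseteq> verts R"
  have R: "graph R" "homogeneous R" "age R = finite_graphs"
    using assms by (auto simp: fraisse_limit_def)
  obtain c where c: "bij_betw c F {0..<card F}"
    using ex_bij_betw_finite_nat[OF F(1)] by blast
  define n where "n = card F"
  have cn: "c a < n" if "a \<in> F" for a using c that by (auto simp: bij_betw_def n_def)
  have c_eq: "c a = c b \<longleftrightarrow> a = b" if "a \<in> F" "b \<in> F" for a b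
    using c that by (auto simp: bij_betw_def dest: inj_onD)
  \<comment> \<open>The numbers below \<open>n\<close> form a copy of \<open>F\<close>;
    \<open>n\<close> itself is the new vertex, joined exactly to the codes of
    \<open>F \<inter> N\<close>.\<close>
  define H :: "nat graph" where
    "H = ({0..n}, {(c a, c b) | a b. a \<in> F \<and> b \<in> F \<and> (a, b) \<in> edges R} \<union>
                  (\<lambda>a. (n, c a)) ` (F \<inter> N) \<union> (\<lambda>a. (c a, n)) ` (F \<inter> N))"
  have "graph H"
  proof (rule graphI)
    show "x \<in> verts H \<and> y \<in> verts H" if "(x, y) \<in> edges H" for x y
      using that cn by (auto simp: H_def less_imp_le)
    show "(x, x) \<notin> edges H" for x
      using graph_edge_irrefl[OF R(1)] cn by (auto simp: H_def c_eq)
    show "(y, x) \<in> edges H" if "(x, y) \<in> edges H" for x y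
      using that graph_edge_commute[OF R(1)] unfolding H_def snd_conv by blast
  qed
  then have "H \<in> age R" by (simp add: R finite_graphs_def H_def)
  then obtain g where g: "graph_embedding H R g" by (auto simp: age_def)
  have gV: "g i \<in> verts R" if "i \<le> n" for i
    using g that by (auto simp: graph_embedding_def H_def)
  have ginj: "inj_on g {0..n}" using g by (simp add: graph_embedding_def H_def)
  have gE: "(g i, g k) \<in> edges R \<longleftrightarrow> (i, k) \<in> edges H" if "i \<le> n" "k \<le> n" for i k
    using g that by (auto simp: graph_embedding_def H_def)
  define e where "e = (\<lambda>a. g (c a))"
  have e_inj: "inj_on e F"
  proof (rule inj_onI)
    fix a b assume ab: "a \<in> F" "b \<in> F" "e a = e b"
    then have "c a = c b" using cn[OF ab(1)] cn[OF ab(2)] by (intro inj_onD[OF ginj]) (auto simp: e_def)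
    then show "a = b" using ab c_eq by blast
  qed
  have eE: "(e a, e b) \<in> edges R \<longleftrightarrow> (a, b) \<in> edges R" if "a \<in> F" "b \<in> F" for a b
  proof -
    have "(e a, e b) \<in> edges R \<longleftrightarrow> (c a, c b) \<in> edges H"
      using gE cn that by (simp add: e_def less_imp_le)
    also have "\<dots> \<longleftrightarrow> (a, b) \<in> edges R"
      using cn[OF that(1)] cn[OF that(2)] that by (auto simp: H_def c_eq)
    finally show ?thesis .
  qed
  \<comment> \<open>This is the finite partial isomorphism to which homogeneity is applied.\<close>
  have "graph_iso (induced R (e ` F)) (induced R F) (the_inv_into F e)"
    unfolding graph_iso_def induced_def
    using e_inj eE bij_betw_the_inv_into[OF inj_on_imp_bij_betw[OF e_inj]]
    by (auto simp: the_inv_into_f_f)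
  moreover have "finite (e ` F)" "e ` F \<subseteq> verts R"
    using F gV cn by (auto simp: e_def less_imp_le)
  ultimately obtain s where s: "graph_iso R R s" and se: "\<forall>x\<in>e ` F. s x = the_inv_into F e x"
    using R(2)[unfolded homogeneous_def, rule_format, of "e ` F" F "the_inv_into F e"] F(2) by blast
  have se': "s (e a) = a" if "a \<in> F" for a
    using se that by (simp add: the_inv_into_f_f[OF e_inj])
  have sE: "(s x, s y) \<in> edges R \<longleftrightarrow> (x, y) \<in> edges R" if "x \<in> verts R" "y \<in> verts R" for x y
    using s that by (simp add: graph_iso_def)
  have sbij: "bij_betw s (verts R) (verts R)" using s by (simp add: graph_iso_def)
  have "s (g n) \<in> verts R" using sbij gV by (auto simp: bij_betw_def)
  \<comment> \<open>Otherwise injectivity of \<open>s\<close> would make \<open>g n\<close> equal to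
    \<open>g (c a)\<close> for some \<open>a\<close> in \<open>F\<close>, although
    \<open>c a < n\<close>.\<close>
  moreover have "s (g n) \<notin> F"
  proof
    assume a: "s (g n) \<in> F"
    then have "s (e (s (g n))) = s (g n)" by (rule se')
    then have "e (s (g n)) = g n"
      using sbij a gV[of n] gV[of "c (s (g n))"] cn[OF a]
      by (auto simp: bij_betw_def inj_on_def e_def)
    then show False
      using inj_onD[OF ginj, of "c (s (g n))" n] cn[OF a] by (simp add: e_def)
  qed
  moreover have "(s (g n), a) \<in> edges R \<longleftrightarrow> a \<in> N" if a: "a \<in> F" for a
  proof -
    have "(s (g n), a) \<in> edges R \<longleftrightarrow> (g n, e a) \<in> edges R"
      using sE[of "g n" "e a"] gV cn[OF a] se'[OF a] by (simp add: e_def)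
    also have "\<dots> \<longleftrightarrow> (n, c a) \<in> edges H"
      using gE cn[OF a] by (simp add: e_def)
    also have "\<dots> \<longleftrightarrow> a \<in> N"
      using a cn by (auto simp: H_def c_eq)
    finally show ?thesis .
  qed
  ultimately show "\<exists>v\<in>verts R - F. \<forall>a\<in>F. (v, a) \<in> edges R \<longleftrightarrow> a \<in> N" by blast
qed

lemma extension_property_algebraically_closed:
  assumes "extension_property G"
  shows "algebraically_closed G"
  unfolding algebraically_closed_def
  using assms by (metis extension_propertyE)

text \<open>If the vertex set were finite, some vertex would be adjacent to all vertices, itself
  included.\<close>

lemma algebraically_closed_infinite:
  assumes "graph G" "algebraically_closed G"
  shows "infinite (verts G)"
  using assms graph_edge_irrefl[OF assms(1)] by (auto simp: algebraically_closed_def)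

section \<open>Back and forth\<close>

text \<open>Finite partial maps are sets of pairs that are pairwise related by \<open>Q\<close>.
  Keeping \<open>Q\<close> abstract lets one argument build both isomorphisms (edges in both
  directions) and bijective homomorphisms (edges preserved only). The injectivity condition on
  \<open>Q\<close> makes the union of the stages a bijection.\<close>

lemma back_and_forth:
  fixes Q :: "'a \<times> 'b \<Rightarrow> 'a \<times> 'b \<Rightarrow> bool"
  assumes cnt: "countable A" "countable B" and ne: "A \<noteq> {}"
    and inj: "\<And>u v. Q u v \<Longrightarrow> fst u \<noteq> fst v \<and> snd u \<noteq> snd v"
    and fwd: "\<And>p x. finite p \<Longrightarrow> p \<subseteq> A \<times> B \<Longrightarrow> pairwise Q p \<Longrightarrow> x \<in> A - fst ` p \<Longrightarrow>
                  \<exists>y\<in>B. \<forall>u\<in>p. Q (x, y) u \<and> Q u (x, y)"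
    and bwd: "\<And>p y. finite p \<Longrightarrow> p \<subseteq> A \<times> B \<Longrightarrow> pairwise Q p \<Longrightarrow> y \<in> B - snd ` p \<Longrightarrow>
                  \<exists>x\<in>A. \<forall>u\<in>p. Q (x, y) u \<and> Q u (x, y)"
  shows "\<exists>f. bij_betw f A B \<and> (\<forall>x\<in>A. \<forall>y\<in>A. x \<noteq> y \<longrightarrow> Q (x, f x) (y, f y))"
proof -
  define I where "I = (\<lambda>p. finite p \<and> p \<subseteq> A \<times> B \<and> pairwise Q p)"
  have forth': "\<exists>q. I q \<and> p \<subseteq> q \<and> x \<in> fst ` q" if "I p" "x \<in> A" for p x
  proof (cases "x \<in> fst ` p")
    case False
    then have "\<exists>y\<in>B. \<forall>u\<in>p. Q (x, y) u \<and> Q u (x, y)"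
      using that by (intro fwd) (auto simp: I_def)
    then obtain y where "y \<in> B" "\<forall>u\<in>p. Q (x, y) u \<and> Q u (x, y)" by blast
    then have "I (insert (x, y) p)" using that by (auto simp: I_def pairwise_insert)
    then show ?thesis by (intro exI[of _ "insert (x, y) p"]) auto
  qed (use that in blast)
  have back': "\<exists>q. I q \<and> p \<subseteq> q \<and> y \<in> snd ` q" if "I p" "y \<in> B" for p y
  proof (cases "y \<in> snd ` p")
    case False
    then have "\<exists>x\<in>A. \<forall>u\<in>p. Q (x, y) u \<and> Q u (x, y)"
      using that by (intro bwd) (auto simp: I_def)
    then obtain x where "x \<in> A" "\<forall>u\<in>p. Q (x, y) u \<and> Q u (x, y)" by blast
    then have "I (insert (x, y) p)" using that by (auto simp: I_def pairwise_insert)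
    then show ?thesis by (intro exI[of _ "insert (x, y) p"]) auto
  qed (use that in blast)
  have I0: "I {}" by (simp add: I_def)
  have neB: "B \<noteq> {}" using fwd[of "{}"] ne by auto
  define a where "a = from_nat_into A"
  define b where "b = from_nat_into B"
  have a: "range a = A" and b: "range b = B"
    using cnt ne neB by (simp_all add: a_def b_def)
  \<comment> \<open>Each stage takes one step forth and one step back, so the enumerations
    \<open>a\<close> and \<open>b\<close> are both exhausted.\<close>
  have "\<exists>P. \<forall>n. I (P n) \<and> (P n \<subseteq> P (Suc n) \<and> a n \<in> fst ` P (Suc n) \<and> b n \<in> snd ` P (Suc n))"
  proof (rule dependent_nat_choice)
    show "\<exists>p. I p" using I0 by blast
  next
    fix p n assume "I p"
    then obtain q where q: "I q" "p \<subseteq> q" "a n \<in> fst ` q" using forth' a by blast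
    then obtain r where r: "I r" "q \<subseteq> r" "b n \<in> snd ` r" using back' b by blast
    then show "\<exists>q. I q \<and> p \<subseteq> q \<and> a n \<in> fst ` q \<and> b n \<in> snd ` q"
      using q by (meson image_mono subset_iff subset_trans)
  qed
  then obtain P where P: "\<And>n. I (P n)" "\<And>n. P n \<subseteq> P (Suc n)"
    "\<And>n. a n \<in> fst ` P (Suc n)" "\<And>n. b n \<in> snd ` P (Suc n)" by blast
  define U where "U = (\<Union>n. P n)"
  have mono: "P m \<subseteq> P n" if "m \<le> n" for m n using P(2) that by (rule lift_Suc_mono_le)
  have pw: "pairwise Q U"
  proof (rule pairwiseI)
    fix u v assume "u \<in> U" "v \<in> U" "u \<noteq> v"
    then obtain m n where "u \<in> P m" "v \<in> P n" by (auto simp: U_def)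
    then have "u \<in> P (max m n)" "v \<in> P (max m n)"
      using mono[of m "max m n"] mono[of n "max m n"] by auto
    then show "Q u v" using P(1)[of "max m n"] \<open>u \<noteq> v\<close> by (auto simp: I_def pairwise_def)
  qed
  have sub: "U \<subseteq> A \<times> B" using P(1) by (fastforce simp: U_def I_def)
  have dom: "\<exists>y. (x, y) \<in> U" if "x \<in> A" for x
    using that a P(3) by (fastforce simp: U_def)
  have ran: "\<exists>x. (x, y) \<in> U" if "y \<in> B" for y
    using that b P(4) by (fastforce simp: U_def)
  have eq: "x = x' \<longleftrightarrow> y = y'" if "(x, y) \<in> U" "(x', y') \<in> U" for x y x' y'
    using pairwiseD[OF pw that] inj by fastforce
  obtain f where f: "\<And>x. x \<in> A \<Longrightarrow> (x, f x) \<in> U" using dom by metis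
  have "inj_on f A" using f eq by (metis inj_onI)
  moreover have "f ` A = B"
  proof
    show "f ` A \<subseteq> B" using f sub by blast
    show "B \<subseteq> f ` A"
    proof
      fix y assume "y \<in> B"
      then obtain x where x: "(x, y) \<in> U" using ran by blast
      then have "x \<in> A" using sub by blast
      then show "y \<in> f ` A" using f x eq by blast
    qed
  qed
  moreover have "Q (x, f x) (y, f y)" if "x \<in> A" "y \<in> A" "x \<noteq> y" for x y
    using pairwiseD[OF pw f[OF that(1)] f[OF that(2)]] that by simp
  ultimately show ?thesis by (auto simp: bij_betw_def)
qed

text \<open>The extension property serves in both directions: a new vertex is matched with one that
  has the corresponding adjacencies to all vertices used so far.\<close>

lemma extension_property_unique:
  fixes G :: "'a graph" and H :: "'b graph"
  assumes G: "graph G" "countable (verts G)" "extension_property G"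
    and H: "graph H" "countable (verts H)" "extension_property H"
  shows "\<exists>f. graph_iso G H f"
proof -
  define Q where "Q = (\<lambda>u v. fst u \<noteq> fst v \<and> snd u \<noteq> snd v \<and>
    ((fst u, fst v) \<in> edges G \<longleftrightarrow> (snd u, snd v) \<in> edges H))"
  have Q_sym: "Q u v \<longleftrightarrow> Q v u" for u v
    using graph_edge_commute[OF G(1), of "fst u" "fst v"] graph_edge_commute[OF H(1), of "snd u" "snd v"]
    by (auto simp: Q_def)
  have "\<exists>f. bij_betw f (verts G) (verts H) \<and>
            (\<forall>x\<in>verts G. \<forall>y\<in>verts G. x \<noteq> y \<longrightarrow> Q (x, f x) (y, f y))"
  proof (rule back_and_forth)
    show "verts G \<noteq> {}"
      using algebraically_closed_infinite extension_property_algebraically_closed G by fastforce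
    show "fst u \<noteq> fst v \<and> snd u \<noteq> snd v" if "Q u v" for u v using that by (simp add: Q_def)
  next
    fix p x assume p: "finite p" "p \<subseteq> verts G \<times> verts H" "pairwise Q p" and x: "x \<in> verts G - fst ` p"
    have "finite (snd ` p)" "snd ` p \<subseteq> verts H" using p by auto
    \<comment> \<open>The prescribed neighbours are the partners under \<open>p\<close> of the
      neighbours of \<open>x\<close>.\<close>
    then obtain y where y: "y \<in> verts H" "y \<notin> snd ` p"
      "\<And>a. a \<in> snd ` p \<Longrightarrow> (y, a) \<in> edges H \<longleftrightarrow> a \<in> {b. \<exists>c. (c, b) \<in> p \<and> (x, c) \<in> edges G}"
      by (rule extension_propertyE[OF H(3),
            where N = "{b. \<exists>c. (c, b) \<in> p \<and> (x, c) \<in> edges G}"]) blast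
    have "Q (x, y) u" if u: "u \<in> p" for u
    proof -
      obtain c b where cb: "u = (c, b)" by force
      have "c' = c" if "(c', b) \<in> p" for c'
        using pairwiseD[OF p(3) that u[unfolded cb]] by (auto simp: Q_def)
      then have "b \<in> {b. \<exists>c. (c, b) \<in> p \<and> (x, c) \<in> edges G} \<longleftrightarrow> (x, c) \<in> edges G"
        using u cb by blast
      moreover have "b \<in> snd ` p" "c \<in> fst ` p" using u cb by force+
      ultimately show ?thesis using x y(2) y(3)[of b] cb by (auto simp: Q_def)
    qed
    then show "\<exists>y\<in>verts H. \<forall>u\<in>p. Q (x, y) u \<and> Q u (x, y)" using y(1) Q_sym by blast
  next
    fix p y assume p: "finite p" "p \<subseteq> verts G \<times> verts H" "pairwise Q p" and y: "y \<in> verts H - snd ` p"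
    have "finite (fst ` p)" "fst ` p \<subseteq> verts G" using p by auto
    then obtain x where x: "x \<in> verts G" "x \<notin> fst ` p"
      "\<And>a. a \<in> fst ` p \<Longrightarrow> (x, a) \<in> edges G \<longleftrightarrow> a \<in> {c. \<exists>b. (c, b) \<in> p \<and> (y, b) \<in> edges H}"
      by (rule extension_propertyE[OF G(3),
            where N = "{c. \<exists>b. (c, b) \<in> p \<and> (y, b) \<in> edges H}"]) blast
    have "Q (x, y) u" if u: "u \<in> p" for u
    proof -
      obtain c b where cb: "u = (c, b)" by force
      have "b' = b" if "(c, b') \<in> p" for b'
        using pairwiseD[OF p(3) that u[unfolded cb]] by (auto simp: Q_def)
      then have "c \<in> {c. \<exists>b. (c, b) \<in> p \<and> (y, b) \<in> edges H} \<longleftrightarrow> (y, b) \<in> edges H"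
        using u cb by blast
      moreover have "b \<in> snd ` p" "c \<in> fst ` p" using u cb by force+
      ultimately show ?thesis using y x(2) x(3)[of c] cb by (auto simp: Q_def)
    qed
    then show "\<exists>x\<in>verts G. \<forall>u\<in>p. Q (x, y) u \<and> Q u (x, y)" using x(1) Q_sym by blast
  qed (use G H in auto)
  then obtain f where f: "bij_betw f (verts G) (verts H)"
    and Q: "\<And>x y. x \<in> verts G \<Longrightarrow> y \<in> verts G \<Longrightarrow> x \<noteq> y \<Longrightarrow> Q (x, f x) (y, f y)" by blast
  have "(x, y) \<in> edges G \<longleftrightarrow> (f x, f y) \<in> edges H" if "x \<in> verts G" "y \<in> verts G" for x y
    using Q[OF that] graph_edge_irrefl[OF G(1)] graph_edge_irrefl[OF H(1)]
    by (cases "x = y") (auto simp: Q_def)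
  then show ?thesis using f unfolding graph_iso_def by blast
qed

text \<open>Going forth, \<open>x\<close> is sent to a common neighbour of all values used so far,
  so every edge is preserved. Going back, \<open>y\<close> receives a preimage with no edge to the
  vertices used so far, so there is nothing to preserve.\<close>

lemma bijective_hom_onto_algebraically_closed:
  fixes G :: "'a graph" and H :: "'b graph"
  assumes G: "graph G" "countable (verts G)" "extension_property G"
    and H: "graph H" "countable (verts H)" "algebraically_closed H"
  shows "\<exists>f. graph_hom G H f \<and> bij_betw f (verts G) (verts H)"
proof -
  define Q where "Q = (\<lambda>u v. fst u \<noteq> fst v \<and> snd u \<noteq> snd v \<and>
    ((fst u, fst v) \<in> edges G \<longrightarrow> (snd u, snd v) \<in> edges H))"
  have Q_sym: "Q u v \<longleftrightarrow> Q v u" for u v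
    using graph_edge_commute[OF G(1), of "fst u" "fst v"] graph_edge_commute[OF H(1), of "snd u" "snd v"]
    by (auto simp: Q_def)
  have "\<exists>f. bij_betw f (verts G) (verts H) \<and>
            (\<forall>x\<in>verts G. \<forall>y\<in>verts G. x \<noteq> y \<longrightarrow> Q (x, f x) (y, f y))"
  proof (rule back_and_forth)
    show "verts G \<noteq> {}"
      using algebraically_closed_infinite extension_property_algebraically_closed G by fastforce
    show "fst u \<noteq> fst v \<and> snd u \<noteq> snd v" if "Q u v" for u v using that by (simp add: Q_def)
  next
    fix p x assume p: "finite p" "p \<subseteq> verts G \<times> verts H" "pairwise Q p" and x: "x \<in> verts G - fst ` p"
    have "finite (snd ` p)" "snd ` p \<subseteq> verts H" using p by auto
    then obtain y where y: "y \<in> verts H" "\<And>a. a \<in> snd ` p \<Longrightarrow> (y, a) \<in> edges H"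
      using H(3) unfolding algebraically_closed_def by metis
    \<comment> \<open>The value \<open>y\<close> is new because it is adjacent to every old value
      and edges are irreflexive.\<close>
    have "Q (x, y) u" if u: "u \<in> p" for u
      using y(2)[of "snd u"] u x graph_edge_irrefl[OF H(1)] by (auto simp: Q_def)
    then show "\<exists>y\<in>verts H. \<forall>u\<in>p. Q (x, y) u \<and> Q u (x, y)" using y(1) Q_sym by blast
  next
    fix p y assume p: "finite p" "p \<subseteq> verts G \<times> verts H" "pairwise Q p" and y: "y \<in> verts H - snd ` p"
    have "finite (fst ` p)" "fst ` p \<subseteq> verts G" using p by auto
    then obtain x where x: "x \<in> verts G" "x \<notin> fst ` p"
      "\<And>a. a \<in> fst ` p \<Longrightarrow> (x, a) \<in> edges G \<longleftrightarrow> a \<in> {}"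
      using extension_propertyE[OF G(3)] by metis
    have "Q (x, y) u" if u: "u \<in> p" for u
      using x y u by (force simp: Q_def image_iff)
    then show "\<exists>x\<in>verts G. \<forall>u\<in>p. Q (x, y) u \<and> Q u (x, y)" using x(1) Q_sym by blast
  qed (use G H in auto)
  then obtain f where f: "bij_betw f (verts G) (verts H)"
    and Q: "\<And>x y. x \<in> verts G \<Longrightarrow> y \<in> verts G \<Longrightarrow> x \<noteq> y \<Longrightarrow> Q (x, f x) (y, f y)" by blast
  have "(f x, f y) \<in> edges H" if "(x, y) \<in> edges G" for x y
    using Q[of x y] that graph_edges[OF G(1)] by (auto simp: Q_def)
  then show ?thesis using f bij_betw_imp_funcset[OF f] unfolding graph_hom_def by blast
qed

section \<open>Embeddings along which all homomorphisms extend\<close>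

text \<open>Even numbers carry the given graph; the odd number \<open>2m + 1\<close> is joined to the finitely many
  smaller vertices coded by the binary digits of \<open>m\<close>. Every finite set of vertices is coded in this
  way, which gives the extension property, and a homomorphism on the even numbers extends to
  the odd ones one at a time because each of them has only finitely many earlier neighbours.\<close>

definition ext_verts :: "nat graph \<Rightarrow> nat set" where
  "ext_verts D = {v. even v \<longrightarrow> v div 2 \<in> verts D}"

definition ext_graph :: "nat graph \<Rightarrow> nat graph" where
  "ext_graph D = (ext_verts D,
     {(u, v). u \<in> ext_verts D \<and> v \<in> ext_verts D \<and>
        (even u \<and> even v \<and> (u div 2, v div 2) \<in> edges D \<or>
         odd u \<and> v \<in> set_decode (u div 2) \<or> odd v \<and> u \<in> set_decode (v div 2))})"

text \<open>A binary digit at position \<open>x\<close> forces \<open>2 ^ x \<le> m\<close>, and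
  \<open>x < 2 ^ x\<close>. Thus coded neighbours precede the vertex coding them, which makes
  recursion along the vertices possible.\<close>

lemma set_decode_less: "x \<in> set_decode m \<Longrightarrow> x < m"
proof -
  assume x: "x \<in> set_decode m"
  have "(2::nat) ^ x \<le> m"
  proof (rule ccontr)
    assume "\<not> (2::nat) ^ x \<le> m"
    then have "m div 2 ^ x = 0" by simp
    then show False using x by (simp add: set_decode_def)
  qed
  then show "x < m" using less_exp[of x] by linarith
qed

lemma set_decode_half_less: "x \<in> set_decode (m div 2) \<Longrightarrow> x < m"
  using set_decode_less[of x "m div 2"] by linarith

lemma graph_ext_graph:
  assumes "graph D"
  shows "graph (ext_graph D)"
proof (rule graphI)
  show "(x, x) \<notin> edges (ext_graph D)" for x
    using graph_edge_irrefl[OF assms] set_decode_half_less[of x x] by (auto simp: ext_graph_def)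
  show "(y, x) \<in> edges (ext_graph D)" if "(x, y) \<in> edges (ext_graph D)" for x y
    using that graph_edge_commute[OF assms] by (auto simp: ext_graph_def)
qed (auto simp: ext_graph_def)

lemma extension_property_ext_graph: "extension_property (ext_graph D)"
  unfolding extension_property_def
proof (intro allI impI, elim conjE)
  fix F N assume F: "finite F" "F \<subseteq> verts (ext_graph D)"
  \<comment> \<open>A number above all of \<open>F\<close>. Adding it to the coded set pushes
    \<open>m\<close>, and so \<open>v\<close>, above \<open>F\<close>; then no element of
    \<open>F\<close> can code \<open>v\<close>, and the edges from \<open>v\<close> to
    \<open>F\<close> are those coded by \<open>v\<close>.\<close>
  define z where "z = 2 * (\<Sum>F) + 1"
  have zF: "a < z" if "a \<in> F" for a
    using member_le_sum[of a F "\<lambda>x. x"] F(1) that by (simp add: z_def)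
  define m where "m = set_encode (insert z (F \<inter> N))"
  have dec: "set_decode m = insert z (F \<inter> N)" using F(1) by (simp add: m_def)
  then have zm: "z < m" using set_decode_less by blast
  define v where "v = 2 * m + 1"
  have v: "odd v" "v div 2 = m" by (auto simp: v_def)
  have vF: "v \<notin> F" using zF zm by (fastforce simp: v_def)
  have "(v, a) \<in> edges (ext_graph D) \<longleftrightarrow> a \<in> N" if a: "a \<in> F" for a
  proof -
    have "v \<notin> set_decode (a div 2)" using set_decode_half_less[of v a] zF[OF a] zm by (auto simp: v_def)
    moreover have "a \<in> ext_verts D" "v \<in> ext_verts D"
      using F a v by (auto simp: ext_graph_def ext_verts_def)
    ultimately show ?thesis using a zF[OF a] v dec by (auto simp: ext_graph_def)
  qed
  moreover have "v \<in> verts (ext_graph D)" using v by (simp add: ext_graph_def ext_verts_def)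
  ultimately show "\<exists>v\<in>verts (ext_graph D) - F. \<forall>a\<in>F. (v, a) \<in> edges (ext_graph D) \<longleftrightarrow> a \<in> N"
    using vF by blast
qed

lemma hom_extends_to_ext_graph:
  fixes D :: "nat graph" and H :: "'b graph"
  assumes H: "graph H" "algebraically_closed H" and h: "graph_hom D H h"
  shows "\<exists>g. graph_hom (ext_graph D) H g \<and> (\<forall>x\<in>verts D. g (2 * x) = h x)"
proof -
  \<comment> \<open>\<open>P g v y\<close> says that \<open>y\<close> is an admissible value at
    \<open>v\<close>, given the values of \<open>g\<close> at smaller numbers; numbers that are not
    vertices are unconstrained. A choice along the well-order then yields \<open>g\<close>.\<close>
  define P :: "(nat \<Rightarrow> 'b) \<Rightarrow> nat \<Rightarrow> 'b \<Rightarrow> bool" where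
    "P = (\<lambda>g v y. v \<in> ext_verts D \<longrightarrow> y \<in> verts H \<and> (even v \<longrightarrow> y = h (v div 2)) \<and>
    (odd v \<longrightarrow> (\<forall>u\<in>set_decode (v div 2) \<inter> ext_verts D. (y, g u) \<in> edges H)))"
  have "\<exists>g. \<forall>v. P g v (g v)"
  proof (rule dependent_wellorder_choice)
    fix v :: nat and g g' :: "nat \<Rightarrow> 'b" and y assume "\<And>u. u < v \<Longrightarrow> g u = g' u"
    then show "P g v y = P g' v y" using set_decode_half_less[of _ v] by (auto simp: P_def)
  next
    fix v :: nat and g :: "nat \<Rightarrow> 'b" assume IH: "\<And>u. u < v \<Longrightarrow> P g u (g u)"
    show "\<exists>y. P g v y"
    proof (cases "odd v")
      case True
      have "g ` (set_decode (v div 2) \<inter> ext_verts D) \<subseteq> verts H"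
        using IH set_decode_half_less[of _ v] by (auto simp: P_def)
      then obtain y where "y \<in> verts H" "\<forall>a\<in>g ` (set_decode (v div 2) \<inter> ext_verts D). (y, a) \<in> edges H"
        using H(2) unfolding algebraically_closed_def by (meson finite_Int finite_imageI finite_set_decode)
      then show ?thesis using True by (auto simp: P_def)
    next
      case False
      then show ?thesis using h by (auto simp: P_def graph_hom_def ext_verts_def)
    qed
  qed
  then obtain g where g: "\<And>v. P g v (g v)" by blast
  have odd: "(g u, g v) \<in> edges H"
    if "u \<in> ext_verts D" "v \<in> ext_verts D" "odd u" "v \<in> set_decode (u div 2)" for u v
    using g[of u] that by (auto simp: P_def)
  have even: "g v = h (v div 2)" if "v \<in> ext_verts D" "even v" for v
    using g[of v] that by (auto simp: P_def)
  have "graph_hom (ext_graph D) H g"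
    unfolding graph_hom_def
  proof (intro conjI allI impI)
    show "g \<in> verts (ext_graph D) \<rightarrow> verts H" using g by (auto simp: P_def ext_graph_def)
    fix u v assume "(u, v) \<in> edges (ext_graph D)"
    then have uv: "u \<in> ext_verts D" "v \<in> ext_verts D"
      and "even u \<and> even v \<and> (u div 2, v div 2) \<in> edges D \<or>
         odd u \<and> v \<in> set_decode (u div 2) \<or> odd v \<and> u \<in> set_decode (v div 2)"
      by (auto simp: ext_graph_def)
    then consider "even u" "even v" "(u div 2, v div 2) \<in> edges D"
      | "odd u" "v \<in> set_decode (u div 2)" | "odd v" "u \<in> set_decode (v div 2)" by blast
    then show "(g u, g v) \<in> edges H"
    proof cases
      case 1
      then show ?thesis using even uv h by (simp add: graph_hom_def)
    next
      case 2
      then show ?thesis using odd uv by blast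
    next
      case 3
      then show ?thesis using odd[of v u] uv graph_edge_commute[OF H(1)] by blast
    qed
  qed
  moreover have "g (2 * x) = h x" if "x \<in> verts D" for x
    using even[of "2 * x"] that by (simp add: ext_verts_def)
  ultimately show ?thesis by blast
qed

text \<open>After relabelling \<open>D\<close> by natural numbers, its extension
  \<open>ext_graph D'\<close> is countable with the extension property, hence isomorphic to
  \<open>R\<close>. The even vertices become the embedded copy of \<open>D\<close>, and extensions
  of homomorphisms are carried over by the isomorphism.\<close>

lemma extensible_embedding:
  fixes D :: "'d graph" and R :: "'r graph"
  assumes R: "graph R" "countable (verts R)" "extension_property R"
    and D: "graph D" "countable (verts D)"
  shows "\<exists>j. graph_embedding D R j \<and>
           (\<forall>h. graph_hom D R h \<longrightarrow> (\<exists>g. graph_hom R R g \<and> (\<forall>x\<in>verts D. g (j x) = h x)))"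
proof -
  define c where "c = to_nat_on (verts D)"
  have c: "inj_on c (verts D)" using D(2) unfolding c_def by (rule inj_on_to_nat_on)
  define D' where "D' = (c ` verts D, map_prod c c ` edges D)"
  have c_eq: "c x = c y \<longleftrightarrow> x = y" if "x \<in> verts D" "y \<in> verts D" for x y
    using c that by (auto dest: inj_onD)
  have cE: "(c x, c y) \<in> edges D' \<longleftrightarrow> (x, y) \<in> edges D" if "x \<in> verts D" "y \<in> verts D" for x y
    using that graph_edge_verts[OF D(1)] c_eq unfolding D'_def by force
  have D': "graph D'"
  proof (rule graphI)
    show "x \<in> verts D' \<and> y \<in> verts D'" if "(x, y) \<in> edges D'" for x y
      using that graph_edge_verts[OF D(1)] by (auto simp: D'_def)
    show "(x, x) \<notin> edges D'" for x
      using graph_edge_verts[OF D(1)] graph_edge_irrefl[OF D(1)] c_eq by (auto simp: D'_def)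
    show "(y, x) \<in> edges D'" if "(x, y) \<in> edges D'" for x y
      using that graph_edge_commute[OF D(1)] by (force simp: D'_def)
  qed
  obtain i where i: "graph_iso (ext_graph D') R i"
    using extension_property_unique[OF graph_ext_graph[OF D'] countableI_type
        extension_property_ext_graph R] by blast
  have i_bij: "bij_betw i (ext_verts D') (verts R)"
    using i by (simp add: graph_iso_def ext_graph_def)
  have iE: "(i x, i y) \<in> edges R \<longleftrightarrow> (x, y) \<in> edges (ext_graph D')"
    if "x \<in> ext_verts D'" "y \<in> ext_verts D'" for x y
    using i that by (simp add: graph_iso_def ext_graph_def)
  define j where "j = (\<lambda>x. i (2 * c x))"
  have cV: "2 * c x \<in> ext_verts D'" if "x \<in> verts D" for x
    using that by (simp add: ext_verts_def D'_def)
  have "graph_embedding D R j"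
    unfolding graph_embedding_def
  proof (intro conjI ballI)
    show "j \<in> verts D \<rightarrow> verts R" using i_bij cV by (auto simp: j_def bij_betw_def)
    show "inj_on j (verts D)"
    proof (rule inj_onI)
      fix x y assume xy: "x \<in> verts D" "y \<in> verts D" "j x = j y"
      then have "2 * c x = 2 * c y"
        using cV by (intro inj_onD[OF bij_betw_imp_inj_on[OF i_bij]]) (auto simp: j_def)
      then show "x = y" using xy c_eq by simp
    qed
    fix x y assume xy: "x \<in> verts D" "y \<in> verts D"
    have "(j x, j y) \<in> edges R \<longleftrightarrow> (2 * c x, 2 * c y) \<in> edges (ext_graph D')"
      using iE cV xy by (simp add: j_def)
    also have "\<dots> \<longleftrightarrow> (x, y) \<in> edges D" using cV xy cE by (auto simp: ext_graph_def)
    finally show "(x, y) \<in> edges D \<longleftrightarrow> (j x, j y) \<in> edges R" by simp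
  qed
  moreover have "\<exists>g. graph_hom R R g \<and> (\<forall>x\<in>verts D. g (j x) = h x)" if h: "graph_hom D R h" for h
  proof -
    have "graph_hom D' R (\<lambda>n. h (the_inv_into (verts D) c n))"
      using h graph_edge_verts[OF D(1)]
      by (fastforce simp: graph_hom_def D'_def the_inv_into_f_f[OF c])
    then obtain g where g: "graph_hom (ext_graph D') R g"
      "\<forall>x\<in>verts D'. g (2 * x) = h (the_inv_into (verts D) c x)"
      using hom_extends_to_ext_graph[OF R(1) extension_property_algebraically_closed[OF R(3)]] by blast
    define k where "k = the_inv_into (ext_verts D') i"
    have k: "k x \<in> ext_verts D'" "i (k x) = x" if "x \<in> verts R" for x
      using that i_bij unfolding k_def bij_betw_def
      by (auto intro: the_inv_into_into f_the_inv_into_f)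
    have ki: "k (i x) = x" if "x \<in> ext_verts D'" for x
      using that i_bij unfolding k_def bij_betw_def by (auto intro: the_inv_into_f_f)
    have "graph_hom R R (\<lambda>x. g (k x))"
      unfolding graph_hom_def
    proof (intro conjI allI impI)
      show "(\<lambda>x. g (k x)) \<in> verts R \<rightarrow> verts R"
        using g(1) k by (auto simp: graph_hom_def ext_graph_def)
      fix x y assume xy: "(x, y) \<in> edges R"
      then have "(k x, k y) \<in> edges (ext_graph D')"
        using iE[of "k x" "k y"] k graph_edge_verts[OF R(1) xy] by simp
      then show "(g (k x), g (k y)) \<in> edges R" using g(1) by (simp add: graph_hom_def)
    qed
    moreover have "g (k (j x)) = h x" if "x \<in> verts D" for x
      using g(2) that ki[OF cV[OF that]] by (simp add: j_def D'_def the_inv_into_f_f[OF c])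
    ultimately show ?thesis by blast
  qed
  ultimately show ?thesis by blast
qed

section \<open>Green's relations\<close>

context Group.monoid
begin

text \<open>Equality of principal left ideals is mutual divisibility, since the identity places each
  element in its own ideal.\<close>

lemma green_L_iff:
  "(f, g) \<in> green_L G \<longleftrightarrow> f \<in> carrier G \<and> g \<in> carrier G \<and>
     (\<exists>u\<in>carrier G. g = u \<otimes> f) \<and> (\<exists>v\<in>carrier G. f = v \<otimes> g)"
proof -
  have sub: "carrier G #> g \<subseteq> carrier G #> f \<longleftrightarrow> (\<exists>u\<in>carrier G. g = u \<otimes> f)"
    if "f \<in> carrier G" "g \<in> carrier G" for f g
  proof
    assume "carrier G #> g \<subseteq> carrier G #> f"
    moreover have "g \<in> carrier G #> g"
      using that by (force simp: r_coset_def intro!: bexI[of _ \<one>])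
    ultimately show "\<exists>u\<in>carrier G. g = u \<otimes> f" by (auto simp: r_coset_def)
  next
    assume "\<exists>u\<in>carrier G. g = u \<otimes> f"
    then obtain u where u: "u \<in> carrier G" "g = u \<otimes> f" by blast
    have "w \<otimes> g = (w \<otimes> u) \<otimes> f" if "w \<in> carrier G" for w
      using that u \<open>f \<in> carrier G\<close> by (simp add: m_assoc)
    then show "carrier G #> g \<subseteq> carrier G #> f"
      using u by (auto simp: r_coset_def)
  qed
  show ?thesis using sub[of f g] sub[of g f] by (auto simp: green_L_def)
qed

lemma green_R_iff:
  "(f, g) \<in> green_R G \<longleftrightarrow> f \<in> carrier G \<and> g \<in> carrier G \<and>
     (\<exists>u\<in>carrier G. g = f \<otimes> u) \<and> (\<exists>v\<in>carrier G. f = g \<otimes> v)"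
proof -
  have sub: "g <# carrier G \<subseteq> f <# carrier G \<longleftrightarrow> (\<exists>u\<in>carrier G. g = f \<otimes> u)"
    if "f \<in> carrier G" "g \<in> carrier G" for f g
  proof
    assume "g <# carrier G \<subseteq> f <# carrier G"
    moreover have "g \<in> g <# carrier G"
      using that by (force simp: l_coset_def intro!: bexI[of _ \<one>])
    ultimately show "\<exists>u\<in>carrier G. g = f \<otimes> u" by (auto simp: l_coset_def)
  next
    assume "\<exists>u\<in>carrier G. g = f \<otimes> u"
    then obtain u where u: "u \<in> carrier G" "g = f \<otimes> u" by blast
    have "g \<otimes> w = f \<otimes> (u \<otimes> w)" if "w \<in> carrier G" for w
      using that u \<open>f \<in> carrier G\<close> by (simp add: m_assoc)
    then show "g <# carrier G \<subseteq> f <# carrier G"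
      using u by (auto simp: l_coset_def)
  qed
  show ?thesis using sub[of f g] sub[of g f] by (auto simp: green_R_def)
qed

lemma equiv_green_L: "equiv (carrier G) (green_L G)"
  by (rule equivI) (auto simp: green_L_def refl_on_def sym_def trans_def)

lemma equiv_green_R: "equiv (carrier G) (green_R G)"
  by (rule equivI) (auto simp: green_R_def refl_on_def sym_def trans_def)

lemma green_R_class_subset_green_D:
  assumes "(f, g) \<in> green_L G"
  shows "green_R G `` {g} \<subseteq> green_D G `` {f}"
  using assms by (auto simp: green_D_def)

text \<open>With \<open>green_D\<close> defined by an \<open>L\<close>-step before an
  \<open>R\<close>-step, this is the half of the commutation of the two relations that needs an
  argument. If \<open>g' = u \<otimes> g\<close>, then \<open>u \<otimes> f\<close> is the
  intermediate element: left multiplication by \<open>u\<close> respects the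
  \<open>R\<close>-relation of \<open>f\<close> and \<open>g\<close>, and \<open>v\<close> undoes
  \<open>u\<close> on \<open>f\<close> because \<open>f\<close> is a right multiple of
  \<open>g\<close>.\<close>

lemma green_L_class_subset_green_D:
  assumes "(f, g) \<in> green_R G"
  shows "green_L G `` {g} \<subseteq> green_D G `` {f}"
proof
  fix g' assume "g' \<in> green_L G `` {g}"
  then obtain u v where u: "u \<in> carrier G" "g' = u \<otimes> g" and v: "v \<in> carrier G" "g = v \<otimes> g'"
    and g': "g' \<in> carrier G"
    by (auto simp: green_L_iff)
  obtain h k where h: "h \<in> carrier G" "g = f \<otimes> h" and k: "k \<in> carrier G" "f = g \<otimes> k"
    and f: "f \<in> carrier G" and g: "g \<in> carrier G"
    using assms by (auto simp: green_R_iff)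
  have uf: "u \<otimes> f = g' \<otimes> k" using u k g by (metis m_assoc)
  have "g' = (u \<otimes> f) \<otimes> h" using u h f by (metis m_assoc)
  then have "(u \<otimes> f, g') \<in> green_R G"
    unfolding green_R_iff using uf g' h(1) k(1) u(1) f by blast
  moreover have "f = v \<otimes> (u \<otimes> f)" using uf v k g' by (metis m_assoc)
  then have "(f, u \<otimes> f) \<in> green_L G"
    unfolding green_L_iff using u(1) v(1) f by blast
  ultimately show "g' \<in> green_D G `` {f}" by (auto simp: green_D_def)
qed

end

text \<open>The carrier bounds the number of classes from above; the pairwise unrelated elements
  \<open>F S\<close> give one class inside \<open>X\<close> for each set \<open>S\<close> of natural
  numbers.\<close>

lemma continuum_many_classes:
  fixes F :: "nat set \<Rightarrow> 'a"
  assumes r: "equiv A r" and A: "A \<lesssim> (UNIV :: nat set set)"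
    and F: "\<And>S. F S \<in> A" "\<And>S. r `` {F S} \<subseteq> X" "\<And>S T. (F S, F T) \<in> r \<Longrightarrow> S = T"
  shows "{C \<in> A // r. C \<subseteq> X} \<approx> (UNIV :: nat set set)"
proof (rule lepoll_antisym)
  have "A // r = (\<lambda>x. r `` {x}) ` A" by (auto simp: quotient_def)
  then have "A // r \<lesssim> A" by (metis image_lepoll)
  then have "A // r \<lesssim> (UNIV :: nat set set)" using A lepoll_trans by blast
  then show "{C \<in> A // r. C \<subseteq> X} \<lesssim> (UNIV :: nat set set)"
    by (rule lepoll_trans[OF subset_imp_lepoll, rotated]) blast
  show "(UNIV :: nat set set) \<lesssim> {C \<in> A // r. C \<subseteq> X}"
    unfolding lepoll_def
  proof (intro exI conjI)
    show "inj (\<lambda>S. r `` {F S})"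
    proof (rule injI)
      fix S T assume "r `` {F S} = r `` {F T}"
      then have "(F S, F T) \<in> r" using r F(1) by (rule eq_equiv_class)
      then show "S = T" by (rule F(3))
    qed
    show "range (\<lambda>S. r `` {F S}) \<subseteq> {C \<in> A // r. C \<subseteq> X}"
      using F by (auto intro: quotientI)
  qed
qed

text \<open>An endomorphism is coded by its graph as a set of pairs of natural numbers. Being
  extensional, it is determined by its values on the vertices.\<close>

lemma carrier_End_lepoll_continuum:
  assumes "countable (verts G)"
  shows "carrier (End G) \<lesssim> (UNIV :: nat set set)"
  unfolding lepoll_def
proof (intro exI conjI)
  let ?c = "to_nat_on (verts G)"
  let ?code = "\<lambda>f. (\<lambda>x. prod_encode (?c x, ?c (f x))) ` verts G"
  show "inj_on ?code (carrier (End G))"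
  proof (rule inj_onI)
    fix f g assume fg: "f \<in> carrier (End G)" "g \<in> carrier (End G)" "?code f = ?code g"
    have V: "f x \<in> verts G" "g x \<in> verts G" if "x \<in> verts G" for x
      using fg that by (auto simp: End_def graph_hom_def)
    have "f x = g x" if x: "x \<in> verts G" for x
    proof -
      have "prod_encode (?c x, ?c (f x)) \<in> ?code g" using x fg(3) by blast
      then obtain y where "y \<in> verts G" "?c x = ?c y" "?c (f x) = ?c (g y)" by auto
      then show ?thesis using assms x V by simp
    qed
    then show "f = g" using fg by (auto simp: End_def intro: extensionalityI)
  qed
qed simp

theorem theorem3p10:
  fixes R :: "'r graph" and \<Gamma> :: "'a graph"
  assumes "fraisse_limit finite_graphs R"
    and "graph \<Gamma>" and "countable (verts \<Gamma>)" and "algebraically_closed \<Gamma>"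
    and "\<not> isomorphic \<Gamma> R"
  shows "\<exists>f\<in>carrier (End R).
           \<not> regular_elem (End R) f \<and>
           inj_on f (verts R) \<and>
           isomorphic (induced R (f ` verts R)) \<Gamma> \<and>
           {C \<in> carrier (End R) // green_R (End R). C \<subseteq> green_D (End R) `` {f}} \<approx> (UNIV :: nat set set) \<and>
           {C \<in> carrier (End R) // green_L (End R). C \<subseteq> green_D (End R) `` {f}} \<approx> (UNIV :: nat set set)"
proof -
  have R: "graph R" "countable (verts R)" "extension_property R"
    using assms(1) fraisse_limit_extension_property[OF assms(1)] by (auto simp: fraisse_limit_def)
  interpret M: Group.monoid "End R" by (rule monoid_End[OF R(1)])
  have carrierI: "restrict h (verts R) \<in> carrier (End R)" if "graph_hom R R h" for h
    using that graph_edge_verts[OF R(1)] by (auto simp: End_def graph_hom_def Pi_iff)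
  have mult: "(g \<otimes>\<^bsub>End R\<^esub> h) x = g (h x)" if "x \<in> verts R" for g h x
    using that by (simp add: End_def compose_eq)
  have carrierD: "h x \<in> verts R" if "h \<in> carrier (End R)" "x \<in> verts R" for h x
    using that by (auto simp: End_def graph_hom_def)
  have carrier_ext: "g = h"
    if "g \<in> carrier (End R)" "h \<in> carrier (End R)" "\<And>x. x \<in> verts R \<Longrightarrow> g x = h x" for g h
    using that by (auto simp: End_def intro: extensionalityI)

  obtain b where b_hom: "graph_hom R \<Gamma> b" and b_bij: "bij_betw b (verts R) (verts \<Gamma>)"
    using bijective_hom_onto_algebraically_closed[OF R assms(2-4)] by blast
  have bV: "b x \<in> verts \<Gamma>" if "x \<in> verts R" for x using b_hom that by (auto simp: graph_hom_def)

  text \<open>Doubling every vertex of \<open>\<Gamma>\<close> yields one copy of \<open>\<Gamma>\<close> for each set \<open>S\<close> of vertices, and any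
    two of these copies are exchanged by endomorphisms of the doubled graph.\<close>
  define c where "c = to_nat_on (verts \<Gamma>)"
  have c: "bij_betw c (verts \<Gamma>) UNIV"
    unfolding c_def using assms(3) algebraically_closed_infinite[OF assms(2,4)] by (rule to_nat_on_infinite)
  define D :: "('a \<times> bool) graph" where
    "D = (verts \<Gamma> \<times> UNIV, {((x, i), (y, k)) | x i y k. (x, y) \<in> edges \<Gamma>})"
  have D: "graph D" "countable (verts D)"
    using graph_edges[OF assms(2)] assms(3) by (auto simp: D_def graph_def irrefl_def sym_def)
  obtain j where j: "graph_embedding D R j"
    and j_ext: "\<And>h. graph_hom D R h \<Longrightarrow> \<exists>g. graph_hom R R g \<and> (\<forall>x\<in>verts D. g (j x) = h x)"
    using extensible_embedding[OF R D] by blast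
  have jV: "j (x, i) \<in> verts R" if "x \<in> verts \<Gamma>" for x i
    using j that by (auto simp: graph_embedding_def D_def)
  have j_eq: "j (x, i) = j (y, k) \<longleftrightarrow> x = y \<and> i = k" if "x \<in> verts \<Gamma>" "y \<in> verts \<Gamma>" for x i y k
    using j that inj_on_eq_iff[of j "verts D" "(x, i)" "(y, k)"]
    by (simp add: graph_embedding_def D_def)
  have jE: "(j (x, i), j (y, k)) \<in> edges R \<longleftrightarrow> (x, y) \<in> edges \<Gamma>"
    if "x \<in> verts \<Gamma>" "y \<in> verts \<Gamma>" for x i y k
    using j that by (auto simp: graph_embedding_def D_def)
  \<comment> \<open>\<open>e S\<close> embeds \<open>\<Gamma>\<close> by choosing, for each vertex,
    the copy whose label tells whether its number lies in \<open>S\<close>.\<close>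
  define e where "e = (\<lambda>S x. j (x, c x \<in> S))"
  define F where "F = (\<lambda>S. \<lambda>x\<in>verts R. e S (b x))"
  have F_app: "F S x = j (b x, c (b x) \<in> S)" if "x \<in> verts R" for S x
    using that by (simp add: F_def e_def)
  have F_carrier: "F S \<in> carrier (End R)" for S
    unfolding F_def
  proof (rule carrierI, unfold graph_hom_def, intro conjI allI impI)
    show "(\<lambda>x. e S (b x)) \<in> verts R \<rightarrow> verts R" using jV bV by (simp add: e_def)
    fix x y assume "(x, y) \<in> edges R"
    then show "(e S (b x), e S (b y)) \<in> edges R"
      using b_hom jE bV graph_edge_verts[OF R(1)] by (simp add: e_def graph_hom_def)
  qed
  have F_left: "\<exists>u\<in>carrier (End R). F S = u \<otimes>\<^bsub>End R\<^esub> F T" for S T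
  proof -
    \<comment> \<open>Both copies of \<open>x\<close> are sent to the one chosen by
      \<open>S\<close>; an extension of this map to \<open>R\<close> turns \<open>F T\<close> into
      \<open>F S\<close>.\<close>
    have "graph_hom D R (\<lambda>(x, i). e S x)"
      using jV jE graph_edge_verts[OF assms(2)] by (auto simp: graph_hom_def D_def e_def)
    then obtain g where g: "graph_hom R R g" "\<forall>p\<in>verts D. g (j p) = (case p of (x, i) \<Rightarrow> e S x)"
      using j_ext by blast
    have "F S = restrict g (verts R) \<otimes>\<^bsub>End R\<^esub> F T"
    proof (rule carrier_ext)
      fix x assume x: "x \<in> verts R"
      then show "F S x = (restrict g (verts R) \<otimes>\<^bsub>End R\<^esub> F T) x"
        using g(2) bV[OF x] jV[OF bV[OF x]] by (simp add: mult F_app D_def e_def)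
    qed (use F_carrier carrierI[OF g(1)] in auto)
    then show ?thesis using carrierI[OF g(1)] by blast
  qed
  have F_L: "(F S, F T) \<in> green_L (End R)" for S T
    using F_left F_carrier by (auto simp: M.green_L_iff)
  have F_image: "F S ` verts R = e S ` verts \<Gamma>" for S
    using b_bij by (auto simp: F_def bij_betw_def image_image[symmetric])
  have F_R: "S = T" if "(F S, F T) \<in> green_R (End R)" for S T
  proof -
    have "\<exists>u\<in>carrier (End R). F T = F S \<otimes>\<^bsub>End R\<^esub> u" using that by (simp only: M.green_R_iff)
    then obtain u where u: "u \<in> carrier (End R)" "F T = F S \<otimes>\<^bsub>End R\<^esub> u" by (rule bexE)
    have "F T x \<in> F S ` verts R" if "x \<in> verts R" for x
      using u(1) that by (subst u(2)) (simp add: mult carrierD)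
    then have sub: "e T ` verts \<Gamma> \<subseteq> e S ` verts \<Gamma>" unfolding F_image[symmetric] by blast
    \<comment> \<open>An inclusion of images suffices: each image contains exactly one of the two
      copies of every vertex, so the chosen labels must agree.\<close>
    have "n \<in> S \<longleftrightarrow> n \<in> T" for n
    proof -
      obtain x where x: "x \<in> verts \<Gamma>" "n = c x" using c by (auto simp: bij_betw_def)
      then obtain y where "y \<in> verts \<Gamma>" "e T x = e S y" using sub by blast
      then show ?thesis using x by (auto simp: e_def j_eq)
    qed
    then show ?thesis by blast
  qed

  \<comment> \<open>Injectivity, image and non-regularity of \<open>f\<close>\<close>
  define f where "f = F {}"
  have f: "f \<in> carrier (End R)" using F_carrier by (simp add: f_def)
  have f_inj: "inj_on f (verts R)"
    using b_bij bV by (auto simp: f_def F_app j_eq bij_betw_def inj_on_def)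
  have "graph_iso \<Gamma> (induced R (f ` verts R)) (e {})"
    unfolding graph_iso_def
  proof (intro conjI ballI)
    show "bij_betw (e {}) (verts \<Gamma>) (verts (induced R (f ` verts R)))"
      by (simp add: induced_def f_def F_image bij_betw_def) (auto simp: inj_on_def e_def j_eq)
    fix x y assume "x \<in> verts \<Gamma>" "y \<in> verts \<Gamma>"
    then show "(x, y) \<in> edges \<Gamma> \<longleftrightarrow> (e {} x, e {} y) \<in> edges (induced R (f ` verts R))"
      unfolding f_def F_image by (auto simp: induced_def e_def jE)
  qed
  then have iso: "isomorphic (induced R (f ` verts R)) \<Gamma>"
    unfolding isomorphic_def by (blast dest: graph_iso_the_inv_into)
  have nonreg: "\<not> regular_elem (End R) f"
  proof
    assume "regular_elem (End R) f"
    then obtain g where g: "g \<in> carrier (End R)" "f \<otimes>\<^bsub>End R\<^esub> g \<otimes>\<^bsub>End R\<^esub> f = f"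
      by (auto simp: regular_elem_def)
    \<comment> \<open>Injectivity of \<open>f\<close> cancels it on the left in
      \<open>f g f = f\<close>, leaving a homomorphic left inverse. Hence \<open>f\<close> reflects
      edges and \<open>b\<close> is an isomorphism.\<close>
    have gf: "g (f x) = x" if x: "x \<in> verts R" for x
    proof -
      have "f (g (f x)) = f x" using fun_cong[OF g(2), of x] x f by (simp add: mult carrierD)
      then show ?thesis using f_inj x g f by (auto dest: inj_onD simp: carrierD)
    qed
    have "(b x, b y) \<in> edges \<Gamma> \<longleftrightarrow> (x, y) \<in> edges R" if xy: "x \<in> verts R" "y \<in> verts R" for x y
    proof
      assume "(b x, b y) \<in> edges \<Gamma>"
      then have "(f x, f y) \<in> edges R" using xy bV jE by (simp add: f_def F_app)
      then have "(g (f x), g (f y)) \<in> edges R" using g(1) by (simp add: End_def graph_hom_def)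
      then show "(x, y) \<in> edges R" using gf xy by simp
    qed (use b_hom in \<open>simp add: graph_hom_def\<close>)
    then have "graph_iso R \<Gamma> b" using b_bij by (simp add: graph_iso_def)
    then show False using assms(5) unfolding isomorphic_def by (blast dest: graph_iso_the_inv_into)
  qed

  text \<open>Adding isolated vertices to \<open>R\<close> yields, for each set \<open>S\<close> of natural numbers, a retraction
    onto \<open>R\<close> whose kernel determines \<open>S\<close>.\<close>
  have R_inf: "infinite (verts R)"
    by (rule algebraically_closed_infinite[OF R(1) extension_property_algebraically_closed[OF R(3)]])
  \<comment> \<open>The added vertex numbered \<open>n\<close> will be sent to \<open>r\<close> if
    \<open>n\<close> lies in \<open>S\<close> and to \<open>r'\<close> otherwise.\<close>
  obtain r r' where r: "r \<in> verts R" "r' \<in> verts R" "r \<noteq> r'"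
    using infinite_imp_nonempty[OF R_inf] infinite_imp_nonempty[OF infinite_remove[OF R_inf]] by blast
  define D' :: "('r + nat) graph" where
    "D' = (verts R <+> UNIV, {(Inl x, Inl y) | x y. (x, y) \<in> edges R})"
  have D': "graph D'" "countable (verts D')"
    using R(1,2) by (auto simp: D'_def graph_def irrefl_def sym_def)
  obtain k where k: "graph_embedding D' R k"
    and k_ext: "\<And>h. graph_hom D' R h \<Longrightarrow> \<exists>g. graph_hom R R g \<and> (\<forall>x\<in>verts D'. g (k x) = h x)"
    using extensible_embedding[OF R D'] by blast
  have kV: "k (Inl x) \<in> verts R" "k (Inr n) \<in> verts R" if "x \<in> verts R" for x n
    using k that by (auto simp: graph_embedding_def D'_def)
  have "\<exists>h\<in>carrier (End R). (\<forall>x\<in>verts R. h (k (Inl x)) = x) \<and>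
          (\<forall>n. h (k (Inr n)) = (if n \<in> S then r else r'))" for S
  proof -
    have "graph_hom D' R (case_sum (\<lambda>x. x) (\<lambda>n. if n \<in> S then r else r'))"
      using r by (auto simp: graph_hom_def D'_def)
    then obtain g where "graph_hom R R g"
      "\<forall>p\<in>verts D'. g (k p) = case_sum (\<lambda>x. x) (\<lambda>n. if n \<in> S then r else r') p"
      using k_ext by blast
    then show ?thesis
      using kV r by (intro bexI[of _ "restrict g (verts R)"] carrierI) (auto simp: D'_def Plus_def)
  qed
  then obtain H where H: "\<And>S. H S \<in> carrier (End R)" "\<And>S x. x \<in> verts R \<Longrightarrow> H S (k (Inl x)) = x"
    "\<And>S n. H S (k (Inr n)) = (if n \<in> S then r else r')"
    by metis
  \<comment> \<open>A common right inverse of all the maps \<open>H S\<close>.\<close>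
  define s where "s = (\<lambda>x\<in>verts R. k (Inl x))"
  have s: "s \<in> carrier (End R)"
    unfolding s_def
    by (rule carrierI) (use k graph_edge_verts[OF R(1)] in \<open>fastforce simp: graph_embedding_def graph_hom_def D'_def\<close>)
  have fHs: "f \<otimes>\<^bsub>End R\<^esub> H S \<otimes>\<^bsub>End R\<^esub> s = f" for S
    by (rule carrier_ext) (use f H s in \<open>auto simp: mult s_def kV\<close>)
  have fH_R: "(f, f \<otimes>\<^bsub>End R\<^esub> H S) \<in> green_R (End R)" for S
    using f H(1) s fHs[of S] by (auto simp: M.green_R_iff intro: bexI[of _ s])
  have fH_L: "S = T" if "(f \<otimes>\<^bsub>End R\<^esub> H S, f \<otimes>\<^bsub>End R\<^esub> H T) \<in> green_L (End R)" for S T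
  proof -
    \<comment> \<open>A left multiple identifies at least the same vertices, and the injective
      \<open>f\<close> leaves the kernel of \<open>H U\<close> unchanged.\<close>
    have ker: "H U x = H U y" if "(f \<otimes>\<^bsub>End R\<^esub> H V, f \<otimes>\<^bsub>End R\<^esub> H U) \<in> green_L (End R)"
      "H V x = H V y" "x \<in> verts R" "y \<in> verts R" for U V x y
    proof -
      have "\<exists>u\<in>carrier (End R). f \<otimes>\<^bsub>End R\<^esub> H U = u \<otimes>\<^bsub>End R\<^esub> (f \<otimes>\<^bsub>End R\<^esub> H V)"
        using that(1) by (simp only: M.green_L_iff)
      then obtain u where "f \<otimes>\<^bsub>End R\<^esub> H U = u \<otimes>\<^bsub>End R\<^esub> (f \<otimes>\<^bsub>End R\<^esub> H V)"
        by (rule bexE)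
      then have "(f \<otimes>\<^bsub>End R\<^esub> H U) x = (f \<otimes>\<^bsub>End R\<^esub> H U) y"
        using that by (simp add: mult)
      then show ?thesis using that f_inj H(1) by (auto simp: mult carrierD dest: inj_onD)
    qed
    \<comment> \<open>Membership in \<open>V\<close> is read off the kernel, through the fixed
      vertex \<open>k (Inl r)\<close>, which every \<open>H V\<close> sends to
      \<open>r\<close>.\<close>
    have mem: "n \<in> V \<longleftrightarrow> H V (k (Inr n)) = H V (k (Inl r))" for n V
      using H r by auto
    have "(f \<otimes>\<^bsub>End R\<^esub> H T, f \<otimes>\<^bsub>End R\<^esub> H S) \<in> green_L (End R)"
      using that by (auto simp: green_L_def)
    then show ?thesis using ker that kV[OF r(1)] unfolding set_eq_iff mem by blast
  qed

  \<comment> \<open>Counting the classes inside the \<open>D\<close>-class of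
    \<open>f\<close>\<close>
  have "{C \<in> carrier (End R) // green_R (End R). C \<subseteq> green_D (End R) `` {f}} \<approx> (UNIV :: nat set set)"
    using M.equiv_green_R carrier_End_lepoll_continuum[OF R(2)] F_carrier
      M.green_R_class_subset_green_D[OF F_L] F_R
    unfolding f_def by (rule continuum_many_classes)
  moreover have "{C \<in> carrier (End R) // green_L (End R). C \<subseteq> green_D (End R) `` {f}} \<approx> (UNIV :: nat set set)"
    using M.equiv_green_L carrier_End_lepoll_continuum[OF R(2)] M.m_closed[OF f H(1)]
      M.green_L_class_subset_green_D[OF fH_R] fH_L
    by (rule continuum_many_classes)
  ultimately show ?thesis using f nonreg f_inj iso by blast
qed

end
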